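(* Let $k\ge2$, let $B=(1,b_2,\dots,b_k)$ be positive integers with $1<b_2<\cdots<b_k$, let $c=\max\{O_B(r)\mid 0\le r\le b_k-1\}$ and assume $c\ge 2$; let $u=\max\left\{c-1,\left\lceil\frac{(c-1)b_{k-1}}{b_k-b_{k-1}}\right\rceil\right\}$. Let $h,d$ be positive integers with $h\ge\left\lceil\frac{d}{u+c-1}\right\rceil$, and for positive integers $a$ with $\gcd(a,d)=1$ let $A(a)=(a,ha+d,ha+db_2,\dots,ha+db_k)$. Then there exist two sequences of nonnegative integers $W_B=(w_j)_{0\le j\le b_k-1}$ and $R_B=(r_j)_{0\le j\le b_k-1}$ such that for all $a\ge (u+c-1)b_k$ with $\gcd(a,d)=1$, $$g(A(a))=(w_jh-1)a+r_jd+(ha+b_kd)\left(\left\lfloor\frac{a}{b_k}\right\rfloor-u-c+1\right),\quad\text{where } a\equiv j \pmod{b_k}.$$ Moreover, $W_B$ and $R_B$ are both (weakly) increasing in $j$, and $w_{b_k-1}-w_0\le 1$.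
   Context: For $M\in\mathbb{N}$, $O_B(M):=\min\{\sum_{i=1}^k x_i \mid \sum_{i=1}^k b_ix_i=M,\ x_i\in\mathbb{N}\}$ with $b_1=1$. For positive integers $a_1,\dots,a_n$ with $\gcd=1$, the Frobenius number $g(a_1,\dots,a_n)$ is the largest integer not representable as $\sum x_ia_i$ with $x_i\in\mathbb{N}$ (nonnegative integers). *)

theory Defs
  imports Complex_Main
begin

text \<open>
  A tuple \<open>B = (b\<^sub>1, \<dots>, b\<^sub>k)\<close> is a function \<open>b\<close> of which only the values on \<open>{1..k}\<close> matter.
  Since \<open>b\<^sub>1 = 1\<close>, every \<open>M\<close> has a representation, so the \<open>LEAST\<close> below is attained.
\<close>
definition opt_B :: "nat \<Rightarrow> (nat \<Rightarrow> nat) \<Rightarrow> nat \<Rightarrow> nat" where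
  "opt_B k b M =
     (LEAST s. \<exists>x :: nat \<Rightarrow> nat. (\<Sum>i=1..k. b i * x i) = M \<and> s = (\<Sum>i=1..k. x i))"

definition representable :: "nat list \<Rightarrow> int \<Rightarrow> bool" where
  "representable as z \<longleftrightarrow> (\<exists>x :: nat \<Rightarrow> nat. z = int (\<Sum>i<length as. x i * as ! i))"

text \<open>
  For positive entries of gcd 1 the set of non-representable integers is bounded above and contains
  all negative integers, so the greatest element exists; it is \<open>-1\<close> if \<open>1\<close> is an entry.
\<close>
definition frobenius_number :: "nat list \<Rightarrow> int" where
  "frobenius_number as = (GREATEST z. \<not> representable as z)"

definition gen_A :: "nat \<Rightarrow> (nat \<Rightarrow> nat) \<Rightarrow> nat \<Rightarrow> nat \<Rightarrow> nat \<Rightarrow> nat list" where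
  "gen_A k b h d a = a # map (\<lambda>i. h * a + d * b i) [1..<Suc k]"

end

theory Submission
  imports Defs "HOL-Number_Theory.Cong"
begin

text \<open>
  Write \<open>O\<close> for \<open>opt_B k b\<close>. The least element of the semigroup in the residue class of \<open>r d\<close>
  modulo \<open>a\<close>, where \<open>r < a\<close>, is \<open>f r = O r h a + r d\<close>, because \<open>O (r + m a) \<ge> O r\<close> for large
  \<open>a\<close>. Hence the Frobenius number is the maximum of \<open>f\<close> over \<open>r < a\<close>, minus \<open>a\<close>. From \<open>(u - 1) b\<^sub>k\<close> on,
  \<open>O (r + b\<^sub>k) = O r + 1\<close>, so this maximum is attained among the last \<open>b\<^sub>k\<close> values of \<open>r\<close>, and
  these can be shifted by a multiple of \<open>b\<^sub>k\<close> to a window that depends on \<open>a mod b\<^sub>k\<close> only. The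
  lower bound on \<open>h\<close> gives \<open>h a \<ge> d b\<^sub>k\<close>, so within a window \<open>f\<close> is maximised by comparing
  \<open>(O r, r)\<close> lexicographically, which involves neither \<open>h\<close> nor \<open>d\<close>.
\<close>

section \<open>Optimal representations and the semigroup generated by \<open>gen_A\<close>\<close>

lemma opt_B_le:
  assumes "(\<Sum>i=1..k. b i * x i) = M"
  shows "opt_B k b M \<le> (\<Sum>i=1..k. x i)"
  unfolding opt_B_def using assms by (intro Least_le) blast

lemma opt_B_attained:
  assumes "k \<ge> 1" "b 1 = 1"
  obtains x :: "nat \<Rightarrow> nat"
  where "(\<Sum>i=1..k. b i * x i) = M" "opt_B k b M = (\<Sum>i=1..k. x i)"
proof -
  \<comment> \<open>Witness: M copies of the coin \<open>b 1 = 1\<close>.\<close>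
  have "(\<Sum>i=1..k. b i * (if i = 1 then M else 0)) = (\<Sum>i=1..k. if i = 1 then M else 0)"
    using assms by (intro sum.cong) auto
  also have "\<dots> = M"
    using assms by simp
  finally have "\<exists>s. \<exists>x :: nat \<Rightarrow> nat. (\<Sum>i=1..k. b i * x i) = M \<and> s = (\<Sum>i=1..k. x i)"
    by (intro exI[of _ "\<lambda>i. if i = 1 then M else 0"] exI conjI) auto
  then have "\<exists>x :: nat \<Rightarrow> nat. (\<Sum>i=1..k. b i * x i) = M \<and> opt_B k b M = (\<Sum>i=1..k. x i)"
    unfolding opt_B_def by (rule LeastI_ex)
  then show ?thesis
    using that by blast
qed

text \<open>A summand beyond the optimum for M costs \<open>h * a\<close>, so it can be traded for h
  copies of the generator \<open>a\<close>. Only M, its optimum and the number y of copies of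
  \<open>a\<close> remain.\<close>

lemma representable_gen_A:
  assumes "k \<ge> 1" "b 1 = 1"
  shows "representable (gen_A k b h d a) z \<longleftrightarrow>
           (\<exists>y M. z = int (y * a + opt_B k b M * (h * a) + M * d))"
proof -
  have sum_eq: "(\<Sum>i<length (gen_A k b h d a). x i * gen_A k b h d a ! i) =
      x 0 * a + (\<Sum>i=1..k. x i) * (h * a) + (\<Sum>i=1..k. b i * x i) * d" for x :: "nat \<Rightarrow> nat"
  proof -
    have "(\<Sum>i<length (gen_A k b h d a). x i * gen_A k b h d a ! i)
        = x 0 * a + (\<Sum>i<k. x (Suc i) * (h * a + d * b (Suc i)))"
      by (simp add: gen_A_def sum.lessThan_Suc_shift del: sum.lessThan_Suc upt_Suc)
    also have "(\<Sum>i<k. x (Suc i) * (h * a + d * b (Suc i))) = (\<Sum>i=1..k. x i * (h * a + d * b i))"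
      by (simp add: sum.atLeast1_atMost_eq)
    also have "\<dots> = (\<Sum>i=1..k. x i) * (h * a) + (\<Sum>i=1..k. b i * x i) * d"
      by (simp add: sum_distrib_left sum.distrib algebra_simps)
    finally show ?thesis
      by simp
  qed
  show ?thesis
  proof
    assume "representable (gen_A k b h d a) z"
    then obtain x :: "nat \<Rightarrow> nat" where
      z: "z = int (x 0 * a + (\<Sum>i=1..k. x i) * (h * a) + (\<Sum>i=1..k. b i * x i) * d)"
      unfolding representable_def sum_eq by blast
    define M where "M = (\<Sum>i=1..k. b i * x i)"
    have "opt_B k b M \<le> (\<Sum>i=1..k. x i)"
      by (rule opt_B_le) (simp add: M_def)
    then obtain e where e: "(\<Sum>i=1..k. x i) = opt_B k b M + e"
      using le_Suc_ex by blast
    have "z = int ((x 0 + e * h) * a + opt_B k b M * (h * a) + M * d)"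
      unfolding z e M_def[symmetric] by (simp add: algebra_simps)
    then show "\<exists>y M. z = int (y * a + opt_B k b M * (h * a) + M * d)"
      by blast
  next
    assume "\<exists>y M. z = int (y * a + opt_B k b M * (h * a) + M * d)"
    then obtain y M where z: "z = int (y * a + opt_B k b M * (h * a) + M * d)"
      by blast
    obtain x where x: "(\<Sum>i=1..k. b i * x i) = M" "opt_B k b M = (\<Sum>i=1..k. x i)"
      using opt_B_attained[where b = b, OF assms] by metis
    \<comment> \<open>Index 0 counts the generator \<open>a\<close> and lies outside both sums, so
      it is free to be set.\<close>
    have "(\<Sum>i=1..k. b i * (x(0 := y)) i) = M" "(\<Sum>i=1..k. (x(0 := y)) i) = opt_B k b M"
      using x by simp_all
    then have "z = int (\<Sum>i<length (gen_A k b h d a). (x(0 := y)) i * gen_A k b h d a ! i)"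
      unfolding sum_eq z by simp
    then show "representable (gen_A k b h d a) z"
      unfolding representable_def by blast
  qed
qed

text \<open>As d is invertible modulo a, each class is that of \<open>r * d\<close> for one r < a.
  By \<open>opt_mod\<close>, reducing M modulo a lowers both terms, so r itself gives the least
  element of its class; the largest gap of the class is this element minus a.\<close>

lemma frobenius_number_gen_A:
  assumes "k \<ge> 1" "b 1 = 1" "a > 0" "coprime a d" "r < a"
    and opt_mod: "\<And>M. opt_B k b (M mod a) \<le> opt_B k b M"
    and max: "\<And>r'. r' < a \<Longrightarrow>
      opt_B k b r' * (h * a) + r' * d \<le> opt_B k b r * (h * a) + r * d"
  shows "frobenius_number (gen_A k b h d a) = int (opt_B k b r * (h * a) + r * d) - int a"
  unfolding frobenius_number_def
proof (rule Greatest_equality)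
  show "\<not> representable (gen_A k b h d a) (int (opt_B k b r * (h * a) + r * d) - int a)"
  proof
    assume "representable (gen_A k b h d a) (int (opt_B k b r * (h * a) + r * d) - int a)"
    then obtain y M where "int (opt_B k b r * (h * a) + r * d) - int a
        = int (y * a + opt_B k b M * (h * a) + M * d)"
      unfolding representable_gen_A[where b = b, OF assms(1,2)] by blast
    then have "int (opt_B k b r * (h * a) + r * d)
        = int (a + y * a + opt_B k b M * (h * a) + M * d)"
      by simp
    then have eq: "opt_B k b r * (h * a) + r * d = a + y * a + opt_B k b M * (h * a) + M * d"
      by (simp only: of_nat_eq_iff)
    have "(r * d) mod a = (opt_B k b r * h * a + r * d) mod a"
      by simp
    also have "\<dots> = ((1 + y + opt_B k b M * h) * a + M * d) mod a"
      using eq by (simp add: algebra_simps)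
    also have "\<dots> = (M * d) mod a"
      by (metis mod_mult_self3)
    finally have "[r * d = M * d] (mod a)"
      by (simp add: cong_def)
    then have "[r = M] (mod a)"
      using assms(4) by (simp add: cong_mult_rcancel_nat coprime_commute)
    then have r: "r = M mod a"
      using assms(5) by (simp add: cong_def)
    have "opt_B k b r * (h * a) \<le> opt_B k b M * (h * a)"
      unfolding r by (intro mult_right_mono opt_mod) simp
    moreover have "r * d \<le> M * d"
      unfolding r by (intro mult_right_mono) auto
    ultimately show False
      using eq assms(3) by linarith
  qed
next
  fix z
  assume nrep: "\<not> representable (gen_A k b h d a) z"
  show "z \<le> int (opt_B k b r * (h * a) + r * d) - int a"
  proof (rule ccontr)
    assume "\<not> ?thesis"
    then have z: "z > int (opt_B k b r * (h * a) + r * d) - int a"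
      by simp
    have "coprime (int d) (int a)"
      using assms(4) by (simp add: coprime_commute)
    \<comment> \<open>With x inverse to d, the class of z is that of \<open>r' * d\<close> for r' =
      x z mod a.\<close>
    then obtain x where x: "[int d * x = 1] (mod int a)"
      using cong_solve_coprime_int by blast
    define r' where "r' = nat ((x * z) mod int a)"
    have r': "int r' = (x * z) mod int a"
      using assms(3) by (simp add: r'_def)
    have "int r' < int a"
      unfolding r' using assms(3) by simp
    then have "r' < a"
      by simp
    define F where "F = int (opt_B k b r' * (h * a) + r' * d)"
    have "F < z + int a"
      using max[OF \<open>r' < a\<close>] z unfolding F_def by linarith
    have "[int (r' * d) = int d * x * z] (mod int a)"
      unfolding cong_def by (simp add: r' mod_simps algebra_simps)
    also have "[int d * x * z = 1 * z] (mod int a)"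
      using x by (rule cong_mult) simp
    finally have "[int (r' * d) = z] (mod int a)"
      by simp
    moreover have "F = int (r' * d) + int a * int (opt_B k b r' * h)"
      by (simp add: F_def algebra_simps)
    ultimately have "[z = F] (mod int a)"
      by (simp add: cong_def)
    then obtain t where t: "z - F = int a * t"
      by (auto simp: cong_iff_dvd_diff dvd_def)
    \<comment> \<open>z - F is a multiple of a exceeding -a, hence nonnegative: z arises from F by
      adding copies of a.\<close>
    have "int a * (-1) < int a * t"
      using \<open>F < z + int a\<close> t by linarith
    then have "-1 < t"
      using assms(3) by (simp only: mult_less_cancel_left_pos of_nat_0_less_iff)
    then have "t \<ge> 0"
      by simp
    then have "z = int (nat t * a + opt_B k b r' * (h * a) + r' * d)"
      using t by (simp add: F_def algebra_simps)
    then show False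
      using nrep representable_gen_A[where b = b, OF assms(1,2)] by blast
  qed
qed

section \<open>Growth of \<open>opt\<close> along steps of \<open>b k\<close>\<close>

locale coin_system =
  fixes k :: nat and b :: "nat \<Rightarrow> nat" and c u :: nat
  assumes k: "k \<ge> 2" and b_1: "b 1 = 1" and b_mono: "strict_mono_on {1..k} b"
    and c_def: "c = Max {opt_B k b r | r. 0 \<le> r \<and> r \<le> b k - 1}"
    and c_ge: "c \<ge> 2"
    and u_def: "u = max (c - 1)
               (nat \<lceil>(real c - 1) * real (b (k - 1)) / (real (b k) - real (b (k - 1)))\<rceil>)"
begin

abbreviation opt :: "nat \<Rightarrow> nat" where "opt \<equiv> opt_B k b"

lemma b_less: "1 \<le> i \<Longrightarrow> i < j \<Longrightarrow> j \<le> k \<Longrightarrow> b i < b j"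
  using b_mono by (auto simp: strict_mono_on_def)

lemma b_le: "1 \<le> i \<Longrightarrow> i \<le> j \<Longrightarrow> j \<le> k \<Longrightarrow> b i \<le> b j"
  using b_less[of i j] by (cases "i = j") auto

lemma b_k_ge: "b k \<ge> 2"
  using b_less[of 1 k] k b_1 by simp

lemma u_ge: "u \<ge> 1"
  using c_ge by (simp add: u_def)

text \<open>The second entry of the maximum in \<open>u\<close>, cleared of its denominator. It
  yields \<open>N / b (k - 1) >= N / b k + c - 1\<close> for \<open>N >= u * b k\<close>.\<close>

lemma u_gap: "(c - 1) * b (k - 1) \<le> u * (b k - b (k - 1))"
proof -
  have lt: "b (k - 1) < b k"
    using b_less[of "k - 1" k] k by simp
  have "(real c - 1) * real (b (k - 1)) / (real (b k) - real (b (k - 1))) \<le> real u"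
    unfolding u_def by linarith
  then have "(real c - 1) * real (b (k - 1)) \<le> real u * (real (b k) - real (b (k - 1)))"
    using lt by (simp add: divide_le_eq)
  then have "real ((c - 1) * b (k - 1)) \<le> real (u * (b k - b (k - 1)))"
    using lt c_ge by (simp add: of_nat_diff)
  then show ?thesis
    by (simp only: of_nat_le_iff)
qed

lemma opt_attained:
  obtains x :: "nat \<Rightarrow> nat"
  where "(\<Sum>i=1..k. b i * x i) = M" "opt M = (\<Sum>i=1..k. x i)"
  using opt_B_attained[of k b M] k b_1 by auto

lemma opt_add_b_k_le: "opt (M + b k) \<le> opt M + 1"
proof -
  obtain x where x: "(\<Sum>i=1..k. b i * x i) = M" "opt M = (\<Sum>i=1..k. x i)"
    by (rule opt_attained)
  have "(\<Sum>i=1..k. b i * (x i + (if i = k then 1 else 0))) = M + b k"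
    using k unfolding add_mult_distrib2 sum.distrib x(1) by (simp add: if_distrib cong: if_cong)
  from opt_B_le[OF this] show ?thesis
    using k by (simp add: x(2) sum.distrib)
qed

lemma opt_add_mult_le: "opt (M + n * b k) \<le> opt M + n"
proof (induction n)
  case (Suc n)
  have "opt (M + Suc n * b k) = opt (M + n * b k + b k)"
    by (simp add: algebra_simps)
  also have "\<dots> \<le> opt M + Suc n"
    using opt_add_b_k_le[of "M + n * b k"] Suc by simp
  finally show ?case .
qed simp

lemma le_opt_mult: "M \<le> opt M * b k"
proof -
  obtain x where x: "(\<Sum>i=1..k. b i * x i) = M" "opt M = (\<Sum>i=1..k. x i)"
    by (rule opt_attained)
  have "(\<Sum>i=1..k. b i * x i) \<le> (\<Sum>i=1..k. b k * x i)"
    by (intro sum_mono mult_right_mono b_le) auto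
  then show ?thesis
    unfolding x sum_distrib_left[symmetric] by (simp add: mult.commute)
qed

lemma opt_le_c: "s < b k \<Longrightarrow> opt s \<le> c"
  unfolding c_def by (intro Max_ge) auto

lemma opt_le_div: "opt M \<le> M div b k + c"
  using opt_add_mult_le[of "M mod b k" "M div b k"] opt_le_c[of "M mod b k"] b_k_ge by simp

lemma opt_0: "opt 0 = 0"
  using opt_B_le[of b "\<lambda>_. 0" k 0] by simp

text \<open>
  An optimal representation of \<open>M \<ge> u b\<^sub>k\<close> without \<open>b\<^sub>k\<close> has at least \<open>M / b\<^sub>k\<^sub>-\<^sub>1 \<ge> M / b\<^sub>k + c - 1\<close> summands,
  which is no better than taking \<open>b\<^sub>k\<close> as often as possible.
\<close>
lemma opt_add_b_k:
  assumes "M + b k \<ge> u * b k"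
  shows "opt (M + b k) = opt M + 1"
proof (rule antisym[OF opt_add_b_k_le])
  obtain x where x: "(\<Sum>i=1..k. b i * x i) = M + b k" "opt (M + b k) = (\<Sum>i=1..k. x i)"
    by (rule opt_attained)
  show "opt M + 1 \<le> opt (M + b k)"
  proof (cases "x k = 0")
    \<comment> \<open>If the coin \<open>b k\<close> occurs, removing one copy leaves a
      representation of M.\<close>
    case False
    have "(\<Sum>i=1..k. b i * (x(k := x k - 1)) i) + b k
        = (\<Sum>i=1..k. b i * (x(k := x k - 1)) i + (if i = k then b k else 0))"
      using k by (simp add: sum.distrib)
    also have "\<dots> = (\<Sum>i=1..k. b i * x i)"
      using False by (intro sum.cong) (auto simp flip: add_mult_distrib2 mult_Suc_right simp: add.commute[of _ "b k"])
    finally have "(\<Sum>i=1..k. b i * (x(k := x k - 1)) i) = M"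
      using x(1) by simp
    then have "opt M \<le> (\<Sum>i=1..k. (x(k := x k - 1)) i)"
      by (rule opt_B_le)
    also have "(\<Sum>i=1..k. (x(k := x k - 1)) i) + 1
        = (\<Sum>i=1..k. (x(k := x k - 1)) i + (if i = k then 1 else 0))"
      using k by (simp add: sum.distrib)
    also have "\<dots> = opt (M + b k)"
      unfolding x(2) using False by (intro sum.cong) auto
    finally show ?thesis
      by simp
  next
    case True
    let ?B = "b k" and ?b = "b (k - 1)" and ?s = "opt (M + b k)"
    define N where "N = M + ?B"
    have lt: "?b < ?B"
      using b_less[of "k - 1" k] k by simp
    have b_pos: "?b > 0"
      using b_le[of 1 "k - 1"] k b_1 by linarith
    have "N = (\<Sum>i=1..k. b i * x i)"
      unfolding N_def x(1) ..
    also have "\<dots> \<le> (\<Sum>i=1..k. ?b * x i)"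
    proof (rule sum_mono)
      fix i assume i: "i \<in> {1..k}"
      show "b i * x i \<le> ?b * x i"
        using True b_le[of i "k - 1"] i by (cases "i = k") auto
    qed
    finally have N_le: "N \<le> ?b * ?s"
      by (simp add: x(2) sum_distrib_left)
    have "?b * (N + (c - 1) * ?B) = ?b * N + ?B * ((c - 1) * ?b)"
      by (simp add: algebra_simps)
    also have "\<dots> \<le> ?b * N + ?B * (u * (?B - ?b))"
      by (intro add_left_mono mult_left_mono u_gap) simp
    also have "\<dots> = ?b * N + (u * ?B) * (?B - ?b)"
      by (simp add: algebra_simps)
    also have "\<dots> \<le> ?b * N + N * (?B - ?b)"
      using assms unfolding N_def by (intro add_left_mono mult_right_mono) simp_all
    also have "\<dots> = N * (?b + (?B - ?b))"
      by (simp add: algebra_simps)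
    also have "\<dots> = ?B * N"
      using lt by simp
    also have "\<dots> \<le> ?B * (?b * ?s)"
      by (intro mult_left_mono N_le) simp
    finally have "?b * (N + (c - 1) * ?B) \<le> ?b * (?s * ?B)"
      by (simp add: algebra_simps)
    then have bound: "N + (c - 1) * ?B \<le> ?s * ?B"
      using b_pos by simp
    have N_eq: "N = M mod ?B + (M div ?B + 1) * ?B"
      by (simp add: N_def)
    have "opt M \<le> opt (M mod ?B) + M div ?B"
      using opt_add_mult_le[of "M mod ?B" "M div ?B"] by simp
    \<comment> \<open>For remainder 0, \<open>bound\<close> is one short of c + M div B + 1, but
      \<open>opt 0 = 0\<close> makes up for it. A positive remainder makes the inequality strict,
      which supplies the missing one.\<close>
    moreover have "opt (M mod ?B) + (M div ?B + 1) \<le> ?s"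
    proof (cases "M mod ?B = 0")
      case True
      then have "(M div ?B + 1) * ?B \<le> ?s * ?B"
        using bound N_eq by linarith
      then have "M div ?B + 1 \<le> ?s"
        using lt by (metis mult_le_cancel2 not_less_zero neq0_conv)
      then show ?thesis
        by (simp add: True opt_0)
    next
      case False
      then have "(M div ?B + 1 + (c - 1)) * ?B < ?s * ?B"
        using bound N_eq unfolding add_mult_distrib by linarith
      then have "M div ?B + 1 + (c - 1) < ?s"
        by (rule mult_less_cancel2[THEN iffD1, THEN conjunct2])
      then show ?thesis
        using opt_le_c[of "M mod ?B"] lt by simp
    qed
    ultimately show ?thesis
      by simp
  qed
qed

lemma opt_add_mult:
  assumes "M + b k \<ge> u * b k"
  shows "opt (M + n * b k) = opt M + n"
proof (induction n)
  case (Suc n)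
  have "opt (M + Suc n * b k) = opt (M + n * b k + b k)"
    by (simp add: algebra_simps)
  also have "\<dots> = opt M + Suc n"
    using opt_add_b_k[of "M + n * b k"] assms Suc by simp
  finally show ?case .
qed simp

section \<open>Residues modulo \<open>a\<close>, windows and their lexicographic maxima\<close>

lemma opt_mod_le:
  assumes "a \<ge> (u + c - 1) * b k"
  shows "opt (M mod a) \<le> opt M"
proof (cases "M < a")
  \<comment> \<open>M exceeds r by at least \<open>(u + c - 1) * b k\<close>, so it needs at least r
    div b_k + u + c - 1 coins, whereas r can be paid with r div b_k + c; and u >= 1.\<close>
  case False
  define r where "r = M mod a"
  have "M = r + M div a * a"
    by (simp add: r_def)
  moreover have "M div a * a \<ge> a"
    using False by (cases "a = 0") (auto simp: Suc_le_eq div_greater_zero_iff)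
  ultimately have "r + a \<le> M"
    by linarith
  moreover have "r div b k * b k \<le> r"
    by simp
  ultimately have "(r div b k + (u + c - 1)) * b k \<le> M"
    using assms unfolding add_mult_distrib by linarith
  also have "\<dots> \<le> opt M * b k"
    by (rule le_opt_mult)
  finally have "r div b k + (u + c - 1) \<le> opt M"
    using b_k_ge by simp
  then show ?thesis
    using opt_le_div[of r] u_ge unfolding r_def by linarith
qed simp

text \<open>For \<open>a = (u + c - 1 + n) * b k + j\<close>, shifting this window up by
  \<open>n * b k\<close> gives the last \<open>b k\<close> numbers below a. As c >= 2, it starts at
  or beyond \<open>u * b k\<close>, where each such step raises \<open>opt\<close> by exactly
  1.\<close>

definition window :: "nat \<Rightarrow> nat set" where
  "window j = {(u + c - 2) * b k + j ..< (u + c - 2) * b k + j + b k}"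

lemma window_opt_add:
  assumes "x \<in> window j"
  shows "opt (x + n * b k) = opt x + n"
proof (rule opt_add_mult)
  have "u * b k \<le> (u + c - 2) * b k"
    using c_ge by (intro mult_right_mono) auto
  then show "u * b k \<le> x + b k"
    using assms unfolding window_def atLeastLessThan_iff by linarith
qed

definition lex_max :: "nat \<Rightarrow> nat \<Rightarrow> bool" where
  "lex_max j m \<longleftrightarrow> m \<in> window j \<and>
     (\<forall>x\<in>window j. opt x < opt m \<or> opt x = opt m \<and> x \<le> m)"

lemma lex_max_exists: "\<exists>m. lex_max j m"
proof -
  have fin: "finite (window j)" and ne: "window j \<noteq> {}"
    using b_k_ge by (auto simp: window_def)
  define w where "w = Max (opt ` window j)"
  define S where "S = {x \<in> window j. opt x = w}"
  have "w \<in> opt ` window j"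
    unfolding w_def using fin ne by (intro Max_in) auto
  then have S: "finite S" "S \<noteq> {}"
    using fin by (auto simp: S_def)
  have "Max S \<in> S"
    using S by (rule Max_in)
  moreover have "opt x \<le> w" if "x \<in> window j" for x
    unfolding w_def using fin that by (intro Max_ge) auto
  moreover have "x \<le> Max S" if "x \<in> window j" "opt x = w" for x
    using S that by (intro Max_ge) (auto simp: S_def)
  ultimately have "lex_max j (Max S)"
    unfolding lex_max_def S_def by (auto simp: nat_less_le)
  then show ?thesis ..
qed

definition R :: "nat \<Rightarrow> nat" where
  "R j = (SOME m. lex_max j m)"

lemma R_lex_max: "lex_max j (R j)"
  unfolding R_def using lex_max_exists by (rule someI_ex)

lemma R_in_window: "R j \<in> window j"
  using R_lex_max by (simp add: lex_max_def)

lemma opt_le_opt_R: "x \<in> window j \<Longrightarrow> opt x \<le> opt (R j)"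
  using R_lex_max[of j] by (auto simp: lex_max_def)

lemma le_R: "x \<in> window j \<Longrightarrow> opt x = opt (R j) \<Longrightarrow> x \<le> R j"
  using R_lex_max[of j] by (auto simp: lex_max_def)

text \<open>If R i > R j, both points lie in the overlap of the two windows, so each is at least the
  other in the lexicographic order, forcing equality.\<close>

lemma R_mono:
  assumes "i \<le> j"
  shows "R i \<le> R j"
proof (rule ccontr)
  assume "\<not> R i \<le> R j"
  then have "R j \<in> window i" "R i \<in> window j"
    using R_in_window[of i] R_in_window[of j] assms by (auto simp: window_def)
  then show False
    using opt_le_opt_R[of "R j" i] opt_le_opt_R[of "R i" j] le_R[of "R i" j] \<open>\<not> R i \<le> R j\<close>
    by simp
qed

text \<open>If R i falls to the left of \<open>window j\<close>, then R i + b_k lies in that window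
  and has larger \<open>opt\<close>.\<close>

lemma opt_R_mono:
  assumes "i \<le> j" "j < b k"
  shows "opt (R i) \<le> opt (R j)"
proof (cases "R i \<in> window j")
  case False
  then have "R i + b k \<in> window j"
    using R_in_window[of i] assms by (auto simp: window_def)
  then show ?thesis
    using opt_le_opt_R[of "R i + b k" j] window_opt_add[OF R_in_window, of i 1] by simp
qed (rule opt_le_opt_R)

lemma opt_R_spread:
  assumes "j < b k"
  shows "opt (R j) \<le> opt (R 0) + 1"
proof (cases "R j \<in> window 0")
  case True
  then show ?thesis
    using opt_le_opt_R[of "R j" 0] by simp
next
  case False
  \<comment> \<open>Moving back by \<open>b k\<close> re-enters \<open>window 0\<close> and lowers
    \<open>opt\<close> by at most 1.\<close>
  then have "R j - b k \<in> window 0" "R j = R j - b k + b k"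
    using R_in_window[of j] assms by (auto simp: window_def)
  then show ?thesis
    using opt_le_opt_R[of "R j - b k" 0] opt_add_b_k_le[of "R j - b k"] by simp
qed

section \<open>From lexicographic to weighted maximum, and the Frobenius number\<close>

lemma lex_max_weighted:
  assumes "h * a \<ge> d * b k" "x \<in> window j"
  shows "opt x * (h * a) + x * d \<le> opt (R j) * (h * a) + R j * d"
proof (cases "opt x = opt (R j)")
  case True
  then show ?thesis
    using le_R[OF assms(2)] by simp
next
  case False
  \<comment> \<open>One unit of \<open>opt\<close> weighs \<open>h * a >= d * b k\<close>, which
    outweighs any difference of positions within a window.\<close>
  then have "opt x + 1 \<le> opt (R j)"
    using opt_le_opt_R[OF assms(2)] by simp
  then have "(opt x + 1) * (h * a) \<le> opt (R j) * (h * a)"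
    by (rule mult_right_mono) simp
  moreover have "x * d \<le> (R j + b k) * d"
    using assms(2) R_in_window[of j] by (intro mult_right_mono) (auto simp: window_def)
  ultimately show ?thesis
    using assms(1) by (simp add: algebra_simps)
qed

text \<open>Residues r with \<open>r + b k >= u * b k\<close> climb by steps of \<open>b k\<close>,
  gaining weight, until they reach the last \<open>b k\<close> residues. Smaller r lose directly to
  the window maximum in both \<open>opt\<close> and position.\<close>

lemma max_weighted:
  assumes "h * a \<ge> d * b k" "a = (u + c - 1 + n) * b k + j" "r < a"
  shows "opt r * (h * a) + r * d
      \<le> opt (R j + n * b k) * (h * a) + (R j + n * b k) * d"
  using assms(3)
proof (induction "a - r" arbitrary: r rule: less_induct)
  case less
  define P where "P = (u + c - 2) * b k"
  have "u + c - 1 + n = (u + c - 2) + n + 1"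
    using c_ge by simp
  then have a: "a = P + n * b k + b k + j"
    unfolding assms(2) P_def by (simp only: add_mult_distrib mult_1)
  show ?case
  proof (cases "r + b k \<ge> a")
    case True
    then have "r - n * b k \<in> window j" "r = r - n * b k + n * b k"
      using less.prems unfolding a by (auto simp: window_def P_def[symmetric])
    then obtain x where x: "x \<in> window j" "r = x + n * b k"
      by blast
    show ?thesis
      using lex_max_weighted[OF assms(1) x(1)]
      unfolding x(2) window_opt_add[OF x(1)] window_opt_add[OF R_in_window]
      by (simp add: add_mult_distrib)
  next
    case False
    show ?thesis
    proof (cases "r + b k \<ge> u * b k")
      case True
      have "opt r * (h * a) + r * d \<le> opt (r + b k) * (h * a) + (r + b k) * d"
        unfolding opt_add_b_k[OF True] by (intro add_mono mult_right_mono) auto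
      also have "\<dots> \<le> opt (R j + n * b k) * (h * a) + (R j + n * b k) * d"
        using False b_k_ge less.prems by (intro less.hyps) auto
      finally show ?thesis .
    next
      case small: False
      \<comment> \<open>Here r div b_k <= u - 2, so r costs at most u + c - 2 coins, while R j >= (u
        + c - 2) b_k needs at least that many.\<close>
      then have "(r div b k + 1) * b k < u * b k"
        using div_times_less_eq_dividend[of r "b k"] unfolding add_mult_distrib mult_1 by linarith
      then have "r div b k + 1 < u"
        by (rule mult_less_cancel2[THEN iffD1, THEN conjunct2])
      then have opt_r: "opt r \<le> u + c - 2"
        using opt_le_div[of r] by linarith
      have R_ge: "R j \<ge> P"
        using R_in_window[of j] by (simp add: window_def P_def)
      have "(u + c - 2) * b k \<le> opt (R j) * b k"
        using R_ge le_opt_mult[of "R j"] unfolding P_def by linarith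
      then have "u + c - 2 \<le> opt (R j)"
        using b_k_ge by simp
      then have "opt r \<le> opt (R j + n * b k)"
        using opt_r window_opt_add[OF R_in_window, of j n] by simp
      moreover have "r \<le> R j + n * b k"
      proof -
        have "u * b k \<le> P"
          unfolding P_def using c_ge by (intro mult_right_mono) auto
        then show ?thesis
          using R_ge small by linarith
      qed
      ultimately show ?thesis
        by (intro add_mono mult_right_mono) auto
    qed
  qed
qed

lemma frobenius_number_eq:
  fixes h d a :: nat
  assumes "a > 0" "coprime a d" "h * (u + c - 1) \<ge> d" "a \<ge> (u + c - 1) * b k"
  defines "j \<equiv> a mod b k"
  shows "frobenius_number (gen_A k b h d a) =
      (int (opt (R j)) * int h - 1) * int a + int (R j) * int d
      + (int h * int a + int (b k) * int d) * (int (a div b k) - int u - int c + 1)"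
proof -
  \<comment> \<open>n is the last factor of the formula: shifting R j by n b_k raises
    \<open>opt\<close> by n, which adds n (h a + b_k d) to the weight.\<close>
  define n where "n = a div b k - (u + c - 1)"
  have "u + c - 1 \<le> a div b k"
    using assms(4) b_k_ge by (simp add: less_eq_div_iff_mult_less_eq)
  then have n: "a div b k = u + c - 1 + n"
    by (simp add: n_def)
  have a: "a = (u + c - 1 + n) * b k + j"
    unfolding n[symmetric] j_def by simp
  \<comment> \<open>The lower bounds on h and on a combine to the dominance condition of
    \<open>lex_max_weighted\<close>.\<close>
  have "d * b k \<le> h * (u + c - 1) * b k"
    by (intro mult_right_mono assms(3)) simp
  also have "\<dots> = h * ((u + c - 1) * b k)"
    by simp
  also have "\<dots> \<le> h * a"
    by (intro mult_left_mono assms(4)) simp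
  finally have ha: "d * b k \<le> h * a" .
  have "R j + n * b k < (u + c - 2 + n + 1) * b k + j"
    using R_in_window[of j] by (auto simp: window_def algebra_simps)
  also have "\<dots> = a"
  proof -
    have "u + c - 2 + n + 1 = u + c - 1 + n"
      using c_ge by simp
    then show ?thesis
      unfolding a[symmetric] by (simp only: flip: a)
  qed
  finally have lt: "R j + n * b k < a" .
  have "frobenius_number (gen_A k b h d a)
      = int (opt (R j + n * b k) * (h * a) + (R j + n * b k) * d) - int a"
    using k b_1 assms(1,2) lt opt_mod_le[OF assms(4)] max_weighted[OF ha a]
    by (intro frobenius_number_gen_A) auto
  moreover have "int (a div b k) - int u - int c + 1 = int n"
    unfolding n using c_ge by simp
  ultimately show ?thesis
    unfolding window_opt_add[OF R_in_window] by (simp add: algebra_simps)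
qed

end

theorem theorem3p3:
  fixes k c u :: nat and b :: "nat \<Rightarrow> nat"
  assumes "k \<ge> 2"
    and "b 1 = 1"
    and "strict_mono_on {1..k} b"
    and "c = Max {opt_B k b r | r. 0 \<le> r \<and> r \<le> b k - 1}"
    and "c \<ge> 2"
    and "u = max (c - 1)
               (nat \<lceil>(real c - 1) * real (b (k - 1)) / (real (b k) - real (b (k - 1)))\<rceil>)"
  shows "\<exists>W R :: nat \<Rightarrow> nat.
    (\<forall>h d a :: nat.
       h > 0 \<longrightarrow> d > 0 \<longrightarrow> int h \<ge> \<lceil>real d / (real u + real c - 1)\<rceil> \<longrightarrow>
       a > 0 \<longrightarrow> coprime a d \<longrightarrow> a \<ge> (u + c - 1) * b k \<longrightarrow>
       frobenius_number (gen_A k b h d a) =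
         (int (W (a mod b k)) * int h - 1) * int a + int (R (a mod b k)) * int d
         + (int h * int a + int (b k) * int d)
           * (\<lfloor>real a / real (b k)\<rfloor> - int u - int c + 1))
    \<and> mono_on {0..b k - 1} W
    \<and> mono_on {0..b k - 1} R
    \<and> int (W (b k - 1)) - int (W 0) \<le> 1"
proof -
  interpret coin_system k b c u
    using assms by unfold_locales
  have h_bound: "h * (u + c - 1) \<ge> d"
    if "int h \<ge> \<lceil>real d / (real u + real c - 1)\<rceil>" for h d
  proof -
    have "real d / (real u + real c - 1) \<le> real h"
      using that by (simp add: ceiling_le_iff)
    then have "real d \<le> real h * (real u + real c - 1)"
      using c_ge by (simp add: divide_le_eq)
    also have "\<dots> = real (h * (u + c - 1))"
      using c_ge by (simp add: of_nat_diff)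
    finally show ?thesis
      by (simp only: of_nat_le_iff)
  qed
  show ?thesis
  \<comment> \<open>The maximiser \<open>R j\<close> and its optimum are determined by
    \<open>k\<close>, \<open>b\<close>, \<open>c\<close>, \<open>u\<close> and \<open>j\<close>, so
    the same sequences serve all h, d and a.\<close>
  proof (rule exI[of _ "\<lambda>j. opt_B k b (R j)"], rule exI[of _ R], intro conjI allI impI)
    fix h d a :: nat
    assume "int h \<ge> \<lceil>real d / (real u + real c - 1)\<rceil>" "a > 0" "coprime a d"
      "a \<ge> (u + c - 1) * b k"
    then show "frobenius_number (gen_A k b h d a) =
         (int (opt_B k b (R (a mod b k))) * int h - 1) * int a + int (R (a mod b k)) * int d
         + (int h * int a + int (b k) * int d) * (\<lfloor>real a / real (b k)\<rfloor> - int u - int c + 1)"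
      unfolding floor_divide_of_nat_eq by (intro frobenius_number_eq h_bound)
  next
    show "mono_on {0..b k - 1} (\<lambda>j. opt_B k b (R j))"
      using b_k_ge by (intro mono_onI opt_R_mono) auto
    show "mono_on {0..b k - 1} R"
      by (intro mono_onI R_mono)
    show "int (opt_B k b (R (b k - 1))) - int (opt_B k b (R 0)) \<le> 1"
      using opt_R_spread[of "b k - 1"] b_k_ge by simp
  qed
qed

end
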